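(* Let $T$ be a statistic with values in a space $\mathbb{T}$ and sampling distribution $\mathsf{P}_{T|\theta}$, $\theta \in \Theta$, represented by a function $a: \mathbb{U} \times \Theta \to \mathbb{T}$ and a probability measure $\mathsf{P}_U$ on $\mathbb{U}$ in the sense that, for each $\theta \in \Theta$, $a(U,\theta) \sim \mathsf{P}_{T|\theta}$ when $U \sim \mathsf{P}_U$. Let $\Theta_t(u) = \{\theta \in \Theta : t = a(u,\theta)\}$ for $t\in\mathbb{T}$, $u\in\mathbb{U}$, and let $\mathcal{S}$ be a predictive random set on $\mathbb{U}$ with distribution $\mathsf{P}_{\mathcal{S}}$. Define $\Theta_t(\mathcal{S}) = \bigcup_{u \in \mathcal{S}} \Theta_t(u)$ and $\mathsf{pl}_t(\theta) = \mathsf{P}_{\mathcal{S}}\{\Theta_t(\mathcal{S}) \ni \theta\}$. Fix $\theta \in \Theta$. If $\mathcal{S}$ is valid and $\Theta_t(u) \neq \varnothing$ for all pairs $(t,u)$, then $\mathsf{pl}_T(\theta)$ is stochastically no smaller than $\mathsf{Unif}(0,1)$ when $T \sim \mathsf{P}_{T|\theta}$.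
   Context: Setting: $\mathbb{U}$ is a (topological) auxiliary variable space equipped with a $\sigma$-algebra $\mathscr{U}$ containing all closed sets and a probability measure $\mathsf{P}_U$. A predictive random set $\mathcal{S}$ is a random set with distribution $\mathsf{P}_{\mathcal{S}}$ whose possible realizations form a collection $\mathbb{S}$ (its support) of closed subsets of $\mathbb{U}$ with $\varnothing,\mathbb{U} \in \mathbb{S}$. Probabilities written are assumed to be well defined (measurability technicalities are ignored). Contour function: $f_{\mathcal{S}}(u) = \mathsf{P}_{\mathcal{S}}\{\mathcal{S} \ni u\}$ for $u \in \mathbb{U}$. Stochastically no smaller than $\mathsf{Unif}(0,1)$: a $[0,1]$-valued random variable $X$ has this property if $\mathsf{P}\{X \leq \alpha\} \leq \alpha$ for all $\alpha \in (0,1)$. Valid: $\mathcal{S}$ is valid if $f_{\mathcal{S}}(U)$ is stochastically no smaller than $\mathsf{Unif}(0,1)$ when $U \sim \mathsf{P}_U$. *)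

theory Defs
  imports "HOL-Probability.Probability"
begin

text \<open>
  Every basic space is a carrier set: the auxiliary space is \<open>topspace X\<close> for a topology \<open>X\<close>,
  the sample space of the statistic is \<open>space MT\<close> for a measurable space \<open>MT\<close> (only its
  \<open>space\<close> and \<open>sets\<close> matter), and the parameter space is a set \<open>\<Theta>\<close>.
\<close>

definition stoch_no_smaller_unif :: "'w measure \<Rightarrow> ('w \<Rightarrow> real) \<Rightarrow> bool" where
  "stoch_no_smaller_unif M Y \<longleftrightarrow>
     Y \<in> borel_measurable M \<and>
     (\<forall>w\<in>space M. Y w \<in> {0..1}) \<and>
     (\<forall>\<alpha>\<in>{0<..<1}. measure M {w \<in> space M. Y w \<le> \<alpha>} \<le> \<alpha>)"

definition auxiliary_space :: "'u topology \<Rightarrow> 'u measure \<Rightarrow> bool" where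
  "auxiliary_space X PU \<longleftrightarrow>
     prob_space PU \<and> space PU = topspace X \<and> (\<forall>C. closedin X C \<longrightarrow> C \<in> sets PU)"

text \<open>
  A predictive random set is given by its distribution \<open>PS\<close>, a probability measure on a
  collection of sets; the support (the collection of possible realizations) is \<open>space PS\<close>.
\<close>

definition predictive_random_set :: "'u topology \<Rightarrow> 'u set measure \<Rightarrow> bool" where
  "predictive_random_set X PS \<longleftrightarrow>
     prob_space PS \<and> (\<forall>S\<in>space PS. closedin X S) \<and>
     {} \<in> space PS \<and> topspace X \<in> space PS"

definition contour :: "'u set measure \<Rightarrow> 'u \<Rightarrow> real" where
  "contour PS u = measure PS {S \<in> space PS. u \<in> S}"

text \<open>
  The property depends only on the law of \<open>U\<close>, so \<open>U\<close> is taken to be the identity on the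
  probability space \<open>PU\<close>.
\<close>

definition valid_prs :: "'u measure \<Rightarrow> 'u set measure \<Rightarrow> bool" where
  "valid_prs PU PS \<longleftrightarrow> stoch_no_smaller_unif PU (contour PS)"

definition represents ::
  "('u \<Rightarrow> 'p \<Rightarrow> 't) \<Rightarrow> 'u measure \<Rightarrow> 't measure \<Rightarrow> 'p set \<Rightarrow> ('p \<Rightarrow> 't measure) \<Rightarrow> bool" where
  "represents a PU MT \<Theta> PT \<longleftrightarrow>
     (\<forall>\<theta>\<in>\<Theta>. (\<lambda>u. a u \<theta>) \<in> PU \<rightarrow>\<^sub>M MT \<and> distr PU MT (\<lambda>u. a u \<theta>) = PT \<theta>)"

definition param_set :: "('u \<Rightarrow> 'p \<Rightarrow> 't) \<Rightarrow> 'p set \<Rightarrow> 't \<Rightarrow> 'u \<Rightarrow> 'p set" where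
  "param_set a \<Theta> t u = {\<theta> \<in> \<Theta>. t = a u \<theta>}"

definition param_random_set :: "('u \<Rightarrow> 'p \<Rightarrow> 't) \<Rightarrow> 'p set \<Rightarrow> 't \<Rightarrow> 'u set \<Rightarrow> 'p set" where
  "param_random_set a \<Theta> t S = (\<Union>u\<in>S. param_set a \<Theta> t u)"

definition plausibility ::
  "('u \<Rightarrow> 'p \<Rightarrow> 't) \<Rightarrow> 'p set \<Rightarrow> 'u set measure \<Rightarrow> 't \<Rightarrow> 'p \<Rightarrow> real" where
  "plausibility a \<Theta> PS t \<theta> = measure PS {S \<in> space PS. \<theta> \<in> param_random_set a \<Theta> t S}"

end

theory Submission
  imports Defs
begin

text \<open>
  The value \<open>t = a u \<theta>\<close> of the statistic is compatible with \<open>\<theta>\<close> through \<open>u\<close> itself, so every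
  realization of the random set that catches \<open>u\<close> induces a parameter set that catches \<open>\<theta>\<close>. Hence
  the plausibility of \<open>\<theta>\<close> at \<open>a u \<theta>\<close> is at least the contour function at \<open>u\<close>
  (\<open>contour_le_plausibility\<close>). Being stochastically no smaller than uniform passes to pointwise
  larger functions (\<open>stoch_no_smaller_unif_mono\<close>), so validity, which is this property for the
  contour function under \<open>PU\<close>, gives it for the plausibility of \<open>\<theta>\<close> at \<open>a u \<theta>\<close>. The property
  depends only on the law of the variable (\<open>stoch_no_smaller_unif_distr_iff\<close>), and \<open>T\<close> has the law
  of \<open>a U \<theta>\<close>; this carries it from \<open>PU\<close> to the space on which \<open>T\<close> is defined.
\<close>

lemma stoch_no_smaller_unif_mono:
  assumes "finite_measure M" and Y: "stoch_no_smaller_unif M Y"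
    and Z: "Z \<in> borel_measurable M"
    and le: "\<And>w. w \<in> space M \<Longrightarrow> Y w \<le> Z w"
    and le1: "\<And>w. w \<in> space M \<Longrightarrow> Z w \<le> 1"
  shows "stoch_no_smaller_unif M Z"
proof -
  interpret finite_measure M by fact
  have [measurable]: "Y \<in> borel_measurable M"
    using Y by (simp add: stoch_no_smaller_unif_def)
  have range: "Z w \<in> {0..1}" if "w \<in> space M" for w
  proof -
    have "0 \<le> Y w"
      using Y that by (simp add: stoch_no_smaller_unif_def)
    then show ?thesis
      using le[OF that] le1[OF that] by simp
  qed
  have tail: "measure M {w \<in> space M. Z w \<le> \<alpha>} \<le> \<alpha>" if "\<alpha> \<in> {0<..<1}" for \<alpha>
  proof -
    have "measure M {w \<in> space M. Z w \<le> \<alpha>} \<le> measure M {w \<in> space M. Y w \<le> \<alpha>}"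
    proof (rule finite_measure_mono)
      show "{w \<in> space M. Z w \<le> \<alpha>} \<subseteq> {w \<in> space M. Y w \<le> \<alpha>}"
        using le order_trans by blast
      show "{w \<in> space M. Y w \<le> \<alpha>} \<in> sets M"
        by measurable
    qed
    also have "\<dots> \<le> \<alpha>"
      using Y that by (simp add: stoch_no_smaller_unif_def)
    finally show ?thesis .
  qed
  show ?thesis
    using Z range tail by (simp add: stoch_no_smaller_unif_def)
qed

text \<open>
  The range condition constrains \<open>g\<close> on all of \<open>space N\<close> on one side but only on the image of \<open>T\<close>
  on the other, which is why it appears as a hypothesis.
\<close>

lemma stoch_no_smaller_unif_distr_iff:
  assumes T: "T \<in> M \<rightarrow>\<^sub>M N" and g: "g \<in> borel_measurable N"
    and range: "\<And>t. t \<in> space N \<Longrightarrow> g t \<in> {0..1}"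
  shows "stoch_no_smaller_unif (distr M N T) g \<longleftrightarrow> stoch_no_smaller_unif M (\<lambda>w. g (T w))"
proof -
  note [measurable] = T g
  have tail: "measure (distr M N T) {t \<in> space N. g t \<le> \<alpha>} = measure M {w \<in> space M. g (T w) \<le> \<alpha>}"
    for \<alpha>
  proof -
    have "measure (distr M N T) {t \<in> space N. g t \<le> \<alpha>}
        = measure M (T -` {t \<in> space N. g t \<le> \<alpha>} \<inter> space M)"
      by (rule measure_distr) measurable
    also have "T -` {t \<in> space N. g t \<le> \<alpha>} \<inter> space M = {w \<in> space M. g (T w) \<le> \<alpha>}"
      using measurable_space[OF T] by auto
    finally show ?thesis .
  qed
  have "(\<lambda>w. g (T w)) \<in> borel_measurable M"
    by measurable
  moreover have "\<forall>w\<in>space M. g (T w) \<in> {0..1}"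
    using range measurable_space[OF T] by blast
  ultimately show ?thesis
    using g range by (simp add: stoch_no_smaller_unif_def tail)
qed

lemma contour_le_plausibility:
  assumes "finite_measure PS" and "\<theta> \<in> \<Theta>"
    and "{S \<in> space PS. \<theta> \<in> param_random_set a \<Theta> (a u \<theta>) S} \<in> sets PS"
  shows "contour PS u \<le> plausibility a \<Theta> PS (a u \<theta>) \<theta>"
proof -
  have "{S \<in> space PS. u \<in> S} \<subseteq> {S \<in> space PS. \<theta> \<in> param_random_set a \<Theta> (a u \<theta>) S}"
    using \<open>\<theta> \<in> \<Theta>\<close> by (auto simp: param_random_set_def param_set_def)
  then show ?thesis
    unfolding contour_def plausibility_def
    using assms by (intro finite_measure.finite_measure_mono)
qed

theorem proposition2:
  fixes X :: "'u topology" and PU :: "'u measure" and PS :: "'u set measure"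
    and MT :: "'t measure" and \<Theta> :: "'p set" and PT :: "'p \<Rightarrow> 't measure"
    and a :: "'u \<Rightarrow> 'p \<Rightarrow> 't" and \<theta> :: 'p
    and M :: "'w measure" and T :: "'w \<Rightarrow> 't"
  assumes "auxiliary_space X PU"
    and "represents a PU MT \<Theta> PT"
    and "predictive_random_set X PS"
    and "\<theta> \<in> \<Theta>"
    and contour_events: "\<forall>u\<in>space PU. {S \<in> space PS. u \<in> S} \<in> sets PS"
    and plausibility_events:
      "\<forall>t\<in>space MT. {S \<in> space PS. \<theta> \<in> param_random_set a \<Theta> t S} \<in> sets PS"
    and plausibility_measurable: "(\<lambda>t. plausibility a \<Theta> PS t \<theta>) \<in> borel_measurable MT"
    and "valid_prs PU PS"
    and "\<forall>t\<in>space MT. \<forall>u\<in>space PU. param_set a \<Theta> t u \<noteq> {}"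
    and "prob_space M" and "T \<in> M \<rightarrow>\<^sub>M MT" and "distr M MT T = PT \<theta>"
  shows "stoch_no_smaller_unif M (\<lambda>w. plausibility a \<Theta> PS (T w) \<theta>)"
proof -
  let ?pl = "\<lambda>t. plausibility a \<Theta> PS t \<theta>"
  interpret PU: prob_space PU
    using assms(1) by (simp add: auxiliary_space_def)
  interpret PS: prob_space PS
    using assms(3) by (simp add: predictive_random_set_def)
  have a: "(\<lambda>u. a u \<theta>) \<in> PU \<rightarrow>\<^sub>M MT" and law: "distr PU MT (\<lambda>u. a u \<theta>) = PT \<theta>"
    using assms(2) \<open>\<theta> \<in> \<Theta>\<close> by (auto simp: represents_def)
  have range: "?pl t \<in> {0..1}" for t
    by (simp add: plausibility_def)
  have "contour PS u \<le> ?pl (a u \<theta>)" if "u \<in> space PU" for u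
    using plausibility_events measurable_space[OF a that] \<open>\<theta> \<in> \<Theta>\<close>
    by (intro contour_le_plausibility PS.finite_measure_axioms) auto
  moreover have "(\<lambda>u. ?pl (a u \<theta>)) \<in> borel_measurable PU"
    using a plausibility_measurable by (rule measurable_compose)
  moreover have "stoch_no_smaller_unif PU (contour PS)"
    using \<open>valid_prs PU PS\<close> by (simp add: valid_prs_def)
  ultimately have "stoch_no_smaller_unif PU (\<lambda>u. ?pl (a u \<theta>))"
    using range stoch_no_smaller_unif_mono[OF PU.finite_measure_axioms] by simp
  then have "stoch_no_smaller_unif (distr PU MT (\<lambda>u. a u \<theta>)) ?pl"
    using stoch_no_smaller_unif_distr_iff[OF a plausibility_measurable range] by simp
  then have "stoch_no_smaller_unif (distr M MT T) ?pl"
    by (simp add: law \<open>distr M MT T = PT \<theta>\<close>)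
  then show ?thesis
    using stoch_no_smaller_unif_distr_iff[OF \<open>T \<in> M \<rightarrow>\<^sub>M MT\<close> plausibility_measurable range] by simp
qed

end
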